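(* For all integers $n$ (possibly negative) and all integers $k\ge 0$, the following two relations hold: $$\begin{aligned} (n+4)\,\mathrm{op}_{n+3,k+1}(321)=\;&(5n+14)\,\mathrm{op}_{n+2,k+1}(321)+(4n+10)\,\mathrm{op}_{n+2,k}(321)\\ &-(8n+14)\bigl(\mathrm{op}_{n+1,k+1}(321)+\mathrm{op}_{n+1,k}(321)\bigr)\\ &+(4n+4)\bigl(\mathrm{op}_{n,k+1}(321)+\mathrm{op}_{n,k}(321)\bigr), \end{aligned}$$ $$\begin{aligned} (k+1)\,\mathrm{op}_{n+2,k+2}(321)=\;&(4k+4)\bigl(\mathrm{op}_{n+1,k+2}(321)-\mathrm{op}_{n,k+2}(321)\bigr)-(k+2)\,\mathrm{op}_{n+2,k+1}(321)\\ &+(8k+6)\bigl(\mathrm{op}_{n+1,k+1}(321)-\mathrm{op}_{n,k+1}(321)\bigr)\\ &+(4k+2)\bigl(\mathrm{op}_{n+1,k}(321)-\mathrm{op}_{n,k}(321)\bigr). \end{aligned}$$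
   Context: An ordered partition of $[n]=\{1,\dots,n\}$ into $k$ blocks is a sequence $\pi=B_1/B_2/\cdots/B_k$ of nonempty pairwise disjoint subsets with union $[n]$. It contains the pattern $321$ if there exist $1\le i_1<i_2<i_3\le k$ and $b_1\in B_{i_1}$, $b_2\in B_{i_2}$, $b_3\in B_{i_3}$ with $b_1>b_2>b_3$; otherwise it avoids $321$. For $n\ge k\ge1$, $\mathrm{op}_{n,k}(321)$ is the number of ordered partitions of $[n]$ into $k$ blocks that avoid $321$. For other integers $n,k$ the conventions are: $\mathrm{op}_{n,k}(321)=0$ if $n<k$ or $k<0$ or $n<0$, and $\mathrm{op}_{n,0}(321)=\delta_{n,0}$ (equal to $1$ if $n=0$ and $0$ otherwise). *)

theory Defs
  imports Main
begin

definition ordered_partition :: "nat \<Rightarrow> nat \<Rightarrow> nat set list \<Rightarrow> bool" where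
  "ordered_partition n k B \<longleftrightarrow>
     length B = k \<and>
     (\<forall>i<k. B ! i \<noteq> {}) \<and>
     (\<forall>i<k. \<forall>j<k. i \<noteq> j \<longrightarrow> B ! i \<inter> B ! j = {}) \<and>
     (\<Union>i<k. B ! i) = {1..n}"

definition contains_321 :: "nat set list \<Rightarrow> bool" where
  "contains_321 B \<longleftrightarrow>
     (\<exists>i1 i2 i3. i1 < i2 \<and> i2 < i3 \<and> i3 < length B \<and>
        (\<exists>b1 \<in> B ! i1. \<exists>b2 \<in> B ! i2. \<exists>b3 \<in> B ! i3. b1 > b2 \<and> b2 > b3))"

(* Integer-valued and total in both integer arguments, since the recurrences involve
   subtraction and range over negative n as well. *)
definition op_321 :: "int \<Rightarrow> int \<Rightarrow> int" where
  "op_321 n k =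
     (if 1 \<le> k \<and> k \<le> n
      then int (card {B. ordered_partition (nat n) (nat k) B \<and> \<not> contains_321 B})
      else if n = 0 \<and> k = 0 then 1 else 0)"

end

theory Submission
  imports Defs
begin

text \<open>Write $F = \sum_{n,k} \mathrm{op}_{n,k}(321)\, x^n t^k$. Both recurrences are consequences of
$$F = 1 + \sum_{m \ge 1} C_m\, (x - x^2)^m\, t (1 + t)^{m-1},$$
where $C_m$ is the Catalan number (lemma \<open>op_321_eq_sum\<close>). In this form $n$ enters only through
the powers of $y = x - x^2$ and $k$ only through binomial coefficients. The recurrence in $k$ is a
relation between polynomials in $t$, power by power in $y$; the recurrence in $n$ becomes such a
relation after the differential equation of $y^m$ has been used. In both cases what is left is
$(m + 2)\, C_{m+1} = (4m + 2)\, C_m$.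

To obtain the formula for $F$, list the elements block by block, each block in increasing order.
Suppose that $M$ is the maximum so far. The next element is either larger than $M$, or it is the
least remaining one, because a smaller one coming later would complete a 321. Whether it opens a
new block or joins the last one is a free choice, a factor $1 + t$, except when it is smaller than
its predecessor: then it must open a block. Such a descent happens only directly after a new
maximum, and the forbidden joins are again counted by a free choice on a smaller set. If
$L_n(u)$ counts the completions with $n$ elements left, $u$ of them below $M$, when the next element
may join the last block freely, this gives
$$L_n(u) = (1 + t) \sum_{r \ge \max(u-1,\,0)} (L_{n-1}(r) - L_{n-2}(r))$$
(lemmas \<open>card_completions_recurrence\<close> and \<open>card_completions_eq\<close>). The difference is multiplication by
$x - x^2$ and the summation is the recursion of the ballot numbers, so the $m$-th iteration
contributes $(x - x^2)^m (1 + t)^m$ times a ballot number, which for $u = 0$ is $C_m$. At the very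
beginning there is no block to join, so there the factor $1 + t$ is replaced by $t$.\<close>

section \<open>Ballot numbers\<close>

text \<open>A triangle of ballot numbers whose column \<open>u = 0\<close> is the Catalan sequence. The truncated
subtraction makes the columns \<open>u = 0\<close> and \<open>u = 1\<close> coincide from row 1 on, which is what
happens at the boundary of the counting recurrence below.\<close>

primrec ballot :: "nat \<Rightarrow> nat \<Rightarrow> nat" where
  "ballot 0 u = (if u = 0 then 1 else 0)"
| "ballot (Suc m) u = (\<Sum>r = u - 1..m. ballot m r)"

lemma ballot_eq_0: "m < u \<Longrightarrow> ballot m u = 0"
  by (cases m) auto

text \<open>Consecutive entries of row \<open>m + 1\<close> differ by one entry of row \<open>m\<close>, and the right-hand side
satisfies the same difference equation by Pascal's rule; so the formula descends from
\<open>u = m + 1\<close> down to \<open>u = 1\<close>.\<close>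

lemma ballot_closed_form:
  "u \<le> m \<Longrightarrow> int (ballot m u) = int ((2 * m - u) choose m) - int ((2 * m - u) choose Suc m)"
proof (induction m arbitrary: u)
  case 0
  then show ?case by simp
next
  case (Suc m)
  have pos: "1 \<le> v \<Longrightarrow> int (ballot (Suc m) v) =
      int ((2 * Suc m - v) choose Suc m) - int ((2 * Suc m - v) choose Suc (Suc m))"
    if "v \<le> Suc m" for v
    using that
  proof (induction v rule: inc_induct)
    case base
    have "2 * Suc m - Suc m = Suc m" by simp
    then show ?case using Suc.IH[of m] by (simp add: mult_2)
  next
    case (step v)
    then obtain w where v: "v = Suc w" and w: "w < m" by (cases v) auto
    have split: "ballot (Suc m) v = ballot m w + ballot (Suc m) (Suc v)"
      using w v by (simp add: sum.atLeast_Suc_atMost)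
    have "2 * Suc m - v = Suc (2 * m - w)" "2 * Suc m - Suc v = 2 * m - w"
      using w v by auto
    then show ?case
      using split step Suc.IH[of w] w by simp
  qed
  \<comment> \<open>For \<open>u = 0\<close> the formula agrees with the one for \<open>u = 1\<close> because the middle two
    entries of an odd row of Pascal's triangle are equal.\<close>
  show ?case
  proof (cases u)
    case 0
    have eq: "ballot (Suc m) 0 = ballot (Suc m) 1" by simp
    have pascal: "(Suc (2*m) choose m) = (Suc (2*m) choose Suc m)"
      using binomial_symmetric[of m "Suc (2*m)"] by (simp add: mult_2 Suc_diff_le)
    show ?thesis using eq pos[of 1] pascal 0 by simp
  next
    case (Suc w)
    then show ?thesis using pos[of u] Suc.prems by simp
  qed
qed

lemma ballot_0_binomial: "(m + 1) * ballot m 0 = (2 * m) choose m"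
proof -
  have "Suc m * (2*m choose Suc m) = m * (2*m choose m)"
    using binomial_absorb_comp[of "2*m" m] binomial_absorption[of m "2*m"]
    by (metis binomial_absorption binomial_absorb_comp diff_add_inverse mult_2)
  then have "int (Suc m) * int (2*m choose Suc m) = int m * int (2*m choose m)"
    by (metis of_nat_mult)
  then have "int (m + 1) * int (ballot m 0) = int ((2 * m) choose m)"
    unfolding ballot_closed_form[of 0 m, OF le0] by (simp add: right_diff_distrib algebra_simps)
  then show ?thesis by (metis of_nat_eq_iff of_nat_mult)
qed

text \<open>The two-term recurrence of the Catalan numbers.\<close>

lemma ballot_0_Suc: "(m + 2) * ballot (Suc m) 0 = (4 * m + 2) * ballot m 0"
proof -
  have 1: "Suc m * (Suc (2*m) choose Suc m) = Suc (2*m) * (2*m choose m)"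
    by (rule Suc_times_binomial)
  have "(2 * Suc m choose Suc m) = (Suc (2*m) choose m) + (Suc (2*m) choose Suc m)"
    by simp
  also have "(Suc (2*m) choose m) = (Suc (2*m) choose Suc m)"
    using binomial_symmetric[of m "Suc (2*m)"] by (simp add: mult_2 Suc_diff_le)
  finally have 2: "(2 * Suc m choose Suc m) = 2 * (Suc (2*m) choose Suc m)" by simp
  have "(m+1) * ((m + 2) * ballot (Suc m) 0) = (m+1) * (2 * Suc m choose Suc m)"
    using ballot_0_binomial[of "Suc m"] by simp
  also have "\<dots> = 2 * (Suc (2*m) * (2*m choose m))"
    unfolding 2 1[symmetric] by (simp only: Suc_eq_plus1 mult.left_commute)
  also have "\<dots> = (m+1) * ((4*m+2) * ballot m 0)"
    using ballot_0_binomial[of m, symmetric] by (simp add: algebra_simps)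
  finally show ?thesis by (simp only: mult_cancel1) simp
qed

section \<open>Powers of $x - x^2$\<close>

text \<open>The coefficient of $x^n$ in $(x - x^2)^m$. The exponent is an integer, so that shifting a
coefficient sequence needs no side condition.\<close>

primrec quad_coeff :: "nat \<Rightarrow> int \<Rightarrow> int" where
  "quad_coeff 0 n = (if n = 0 then 1 else 0)"
| "quad_coeff (Suc m) n = quad_coeff m (n - 1) - quad_coeff m (n - 2)"

lemma quad_coeff_eq_0: "n < int m \<Longrightarrow> quad_coeff m n = 0"
  by (induction m arbitrary: n) auto

text \<open>The coefficient form of $(1 - x)\,x\,\frac{d}{dx} y^m = m\,(1 - 2x)\,y^m$ for $y = x - x^2$. It
trades the factor $n$ in the recurrence in $n$ for the factor $m$.\<close>

lemma quad_coeff_derivative: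
  "n * quad_coeff m n - (n - 1) * quad_coeff m (n - 1) =
   int m * (quad_coeff m n - 2 * quad_coeff m (n - 1))"
proof (induction m arbitrary: n)
  case 0
  then show ?case by simp
next
  case (Suc m)
  have e: "n - 1 - 1 = n - 2" "n - 2 - 1 = n - 3" "n - 1 - 2 = n - 3" by auto
  show ?case
    using Suc[of "n - 1"] Suc[of "n - 2"] by (simp add: algebra_simps e)
qed

section \<open>The coefficients of the generating function\<close>

text \<open>The coefficient of $y^m t^k$ in $1 + \sum_{m \ge 1} C_m\, y^m\, t (1 + t)^{m-1}$, with $C_m$ the
Catalan number. At $y = x - x^2$ this series is the generating function of the avoiding ordered
partitions, see \<open>op_321_eq_sum\<close>.\<close>

definition op_coeff :: "nat \<Rightarrow> nat \<Rightarrow> int" where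
  "op_coeff m k = (if m = 0 then (if k = 0 then 1 else 0)
     else if k = 0 then 0 else int (m - 1 choose (k - 1)) * int (ballot m 0))"

lemma op_coeff_simps [simp]:
  "op_coeff 0 0 = 1" "op_coeff 0 (Suc k) = 0" "op_coeff (Suc m) 0 = 0"
  "op_coeff (Suc m) (Suc k) = int (m choose k) * int (ballot (Suc m) 0)"
  by (auto simp: op_coeff_def)

text \<open>Comparing $C_{m+1} t (1+t)^m$ with $(1 + t)\,C_m t (1+t)^{m-1}$ leaves only the Catalan
recurrence. The initial term $1$ does not fit this shape; it would disturb only the power
$t^0$, and the statement looks at positive powers of $t$.\<close>

lemma op_coeff_Suc_left:
  "int (m + 2) * op_coeff (Suc m) (Suc k) =
   int (4 * m + 2) * (op_coeff m (Suc k) + op_coeff m k)"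
proof (cases m)
  case 0
  then show ?thesis by (cases k) auto
next
  case (Suc p)
  have cat: "int (m + 2) * int (ballot (Suc m) 0) = int (4 * m + 2) * int (ballot m 0)"
    by (metis ballot_0_Suc of_nat_mult)
  have "op_coeff m (Suc k) + op_coeff m k = int (m choose k) * int (ballot m 0)"
    using Suc by (cases k) (auto simp: algebra_simps)
  then show ?thesis using cat by (simp del: ballot.simps add: mult.left_commute)
qed

text \<open>After Pascal's rule every term is a multiple of \<open>m choose k\<close>: the left-hand factor becomes
\<open>m + 2\<close>, the right-hand one \<open>4 m + 2\<close>, and the Catalan recurrence remains.\<close>

lemma op_coeff_Suc_right:
  "int (k + 1) * op_coeff (Suc m) (k + 2) + int (k + 2) * op_coeff (Suc m) (k + 1) =
   int (4 * k + 4) * op_coeff m (k + 2) + int (8 * k + 6) * op_coeff m (k + 1)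
   + int (4 * k + 2) * op_coeff m k"
proof (cases m)
  case 0
  then show ?thesis by (cases k) auto
next
  case (Suc p)
  have cat: "int (m + 2) * int (ballot (Suc m) 0) = int (4 * m + 2) * int (ballot m 0)"
    by (metis ballot_0_Suc of_nat_mult)
  have "Suc k * (m choose Suc k) + k * (m choose k) = m * (m choose k)"
    by (metis Suc_times_binomial_add binomial_absorb_comp binomial_absorption add.commute
        distrib_right le_add_diff_inverse2 mult_zero_right binomial_eq_0 not_le nat_le_linear)
  then have absorb: "int (Suc k) * int (m choose Suc k) + int k * int (m choose k)
      = int m * int (m choose k)"
    by (metis of_nat_add of_nat_mult)
  have pascal: "op_coeff m (Suc j) + op_coeff m j = int (m choose j) * int (ballot m 0)" for j
    using Suc by (cases j) (auto simp: algebra_simps)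
  have "int (k + 1) * op_coeff (Suc m) (k + 2) + int (k + 2) * op_coeff (Suc m) (k + 1)
     = (int (Suc k) * int (m choose Suc k) + int k * int (m choose k) + 2 * int (m choose k))
        * int (ballot (Suc m) 0)"
    by (simp add: algebra_simps del: ballot.simps)
  also have "\<dots> = int (m choose k) * (int (m + 2) * int (ballot (Suc m) 0))"
    unfolding absorb by (simp add: algebra_simps del: ballot.simps)
  also have "\<dots> = (4 * (int (Suc k) * int (m choose Suc k) + int k * int (m choose k)) 
        + 2 * int (m choose k)) * int (ballot m 0)"
    unfolding cat absorb by (simp add: algebra_simps del: ballot.simps)
  also have "\<dots> = int (4 * k + 4) * (op_coeff m (Suc (Suc k)) + op_coeff m (Suc k))
       + int (4 * k + 2) * (op_coeff m (Suc k) + op_coeff m k)"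
    unfolding pascal by (simp add: algebra_simps del: ballot.simps)
  finally show ?thesis by (simp add: algebra_simps)
qed

section \<open>Avoidance read from the first block on\<close>

text \<open>If \<open>M\<close> is the largest element placed so far, the later blocks must not show the pattern 21
strictly below \<open>M\<close>; a smaller element placed before gives a weaker condition.\<close>

definition contains_21_below :: "nat \<Rightarrow> nat set list \<Rightarrow> bool" where
  "contains_21_below M B \<longleftrightarrow>
     (\<exists>i j. i < j \<and> j < length B \<and> (\<exists>b \<in> B ! i. \<exists>c \<in> B ! j. M > b \<and> b > c))"

definition avoids_after :: "nat \<Rightarrow> nat set list \<Rightarrow> bool" where
  "avoids_after M B \<longleftrightarrow> \<not> contains_321 B \<and> \<not> contains_21_below M B"

text \<open>Ordered partitions of an arbitrary set, in a form that recurses along the list of blocks. The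
set shrinks when elements are removed, so no relabelling to an initial segment is needed.\<close>

fun block_list :: "nat set \<Rightarrow> nat set list \<Rightarrow> bool" where
  "block_list R [] \<longleftrightarrow> R = {}"
| "block_list R (S # B) \<longleftrightarrow> S \<noteq> {} \<and> S \<subseteq> R \<and> block_list (R - S) B"

lemma block_list_Union: "block_list R B \<Longrightarrow> \<Union>(set B) = R"
  by (induction B arbitrary: R) auto

lemma block_list_iff:
  "block_list R B \<longleftrightarrow>
     (\<forall>i<length B. B ! i \<noteq> {}) \<and>
     (\<forall>i<length B. \<forall>j<length B. i \<noteq> j \<longrightarrow> B ! i \<inter> B ! j = {}) \<and>
     (\<Union>i<length B. B ! i) = R"
proof (induction B arbitrary: R)
  case Nil
  then show ?case by auto
next
  case (Cons S B)
  have U: "(\<Union>i<length (S # B). (S # B) ! i) = S \<union> (\<Union>i<length B. B ! i)"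
    by (simp add: lessThan_Suc_eq_insert_0 image_image)
  have D: "(\<forall>i<length (S # B). \<forall>j<length (S # B). i \<noteq> j \<longrightarrow> (S # B) ! i \<inter> (S # B) ! j = {}) \<longleftrightarrow>
     S \<inter> (\<Union>i<length B. B ! i) = {} \<and>
     (\<forall>i<length B. \<forall>j<length B. i \<noteq> j \<longrightarrow> B ! i \<inter> B ! j = {})"
    by (simp add: All_less_Suc2) blast
  have E: "(\<forall>i<length (S # B). (S # B) ! i \<noteq> {}) \<longleftrightarrow> S \<noteq> {} \<and> (\<forall>i<length B. B ! i \<noteq> {})"
    by (simp add: All_less_Suc2)
  show ?case
    unfolding U D E block_list.simps Cons.IH by blast
qed

lemma ordered_partition_iff_block_list:
  "ordered_partition n k B \<longleftrightarrow> length B = k \<and> block_list {1..n} B"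
  by (auto simp: ordered_partition_def block_list_iff)

lemma contains_21_below_Cons:
  "contains_21_below M (S # B) \<longleftrightarrow> contains_21_below M B \<or> (\<exists>b\<in>S. b < M \<and> (\<exists>c\<in>\<Union>(set B). c < b))"
  (is "?L \<longleftrightarrow> ?R")
proof
  assume ?L
  then obtain i j b c where *: "i < j" "j < Suc (length B)" "b \<in> (S # B) ! i" "c \<in> (S # B) ! j" "M > b" "b > c"
    unfolding contains_21_below_def by auto
  then obtain j' where j: "j = Suc j'" by (cases j) auto
  show ?R
  proof (cases i)
    case 0
    then have "b \<in> S" "B ! j' \<in> set B" "c \<in> B ! j'" using * j by auto
    then show ?thesis using * by blast
  next
    case (Suc i')
    then show ?thesis using * j unfolding contains_21_below_def by auto
  qed
next
  assume ?R
  then show ?L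
  proof
    assume "contains_21_below M B"
    then obtain i j where "i < j" "j < length B" "\<exists>b \<in> B ! i. \<exists>c \<in> B ! j. M > b \<and> b > c"
      unfolding contains_21_below_def by auto
    then show ?L unfolding contains_21_below_def
      by (intro exI[of _ "Suc i"] exI[of _ "Suc j"]) auto
  next
    assume "\<exists>b\<in>S. b < M \<and> (\<exists>c\<in>\<Union>(set B). c < b)"
    then obtain b c j where "b \<in> S" "b < M" "j < length B" "c \<in> B ! j" "c < b"
      by (auto simp: in_set_conv_nth)
    then show ?L unfolding contains_21_below_def
      by (intro exI[of _ 0] exI[of _ "Suc j"]) auto
  qed
qed

lemma contains_321_Cons:
  "contains_321 (S # B) \<longleftrightarrow> contains_321 B \<or> (\<exists>a\<in>S. contains_21_below a B)"
  (is "?L \<longleftrightarrow> ?R")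
proof
  assume ?L
  then obtain i j l a b c where *: "i < j" "j < l" "l < Suc (length B)"
    "a \<in> (S # B) ! i" "b \<in> (S # B) ! j" "c \<in> (S # B) ! l" "a > b" "b > c"
    unfolding contains_321_def by auto
  then obtain j' l' where j: "j = Suc j'" "l = Suc l'" by (cases j; cases l) auto
  show ?R
  proof (cases i)
    case 0
    then have "a \<in> S" "j' < l'" "l' < length B" "b \<in> B ! j'" "c \<in> B ! l'" using * j by auto
    then show ?thesis using * unfolding contains_21_below_def by blast
  next
    case (Suc i')
    then have "i' < j' \<and> j' < l' \<and> l' < length B \<and>
        (\<exists>a \<in> B ! i'. \<exists>b \<in> B ! j'. \<exists>c \<in> B ! l'. a > b \<and> b > c)"
      using * j by auto
    then show ?thesis unfolding contains_321_def by blast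
  qed
next
  assume ?R
  then show ?L
  proof
    assume "contains_321 B"
    then obtain i j l where "i < j" "j < l" "l < length B"
      "\<exists>a \<in> B ! i. \<exists>b \<in> B ! j. \<exists>c \<in> B ! l. a > b \<and> b > c"
      unfolding contains_321_def by blast
    then show ?L unfolding contains_321_def
      by (intro exI[of _ "Suc i"] exI[of _ "Suc j"] exI[of _ "Suc l"]) auto
  next
    assume "\<exists>a\<in>S. contains_21_below a B"
    then obtain a i j where "a \<in> S" "i < j" "j < length B" "\<exists>b \<in> B ! i. \<exists>c \<in> B ! j. a > b \<and> b > c"
      unfolding contains_21_below_def by blast
    then show ?L unfolding contains_321_def
      by (intro exI[of _ 0] exI[of _ "Suc i"] exI[of _ "Suc j"]) auto
  qed
qed

lemma avoids_after_Nil [simp]: "avoids_after M []"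
  by (simp add: avoids_after_def contains_21_below_def contains_321_def)

lemma avoids_after_Cons:
  "avoids_after M (S # B) \<longleftrightarrow>
     avoids_after M B \<and> (\<forall>a\<in>S. avoids_after a B) \<and>
     (\<forall>b\<in>S. b < M \<longrightarrow> (\<forall>c\<in>\<Union>(set B). b \<le> c))"
  by (auto simp: avoids_after_def contains_21_below_Cons contains_321_Cons not_less)

lemma avoids_after_mono: "avoids_after M B \<Longrightarrow> M' \<le> M \<Longrightarrow> avoids_after M' B"
  unfolding avoids_after_def contains_21_below_def by (meson less_le_trans)

lemma avoids_after_0: "avoids_after 0 B \<longleftrightarrow> \<not> contains_321 B"
  by (simp add: avoids_after_def contains_21_below_def)

text \<open>The next two lemmas describe how the condition changes when \<open>c\<close>, the least element of the first
block, is taken out. An element below \<open>M\<close> must precede nothing smaller, while an element above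
\<open>M\<close> becomes the new maximum and takes over its constraints.\<close>

lemma avoids_after_insert_below:
  assumes "c < M"
  shows "avoids_after M (insert c S # B) \<longleftrightarrow>
    avoids_after M (S # B) \<and> (\<forall>x\<in>\<Union>(set B). c \<le> x)"
  using assms avoids_after_mono[of M B c] by (auto simp: avoids_after_Cons)

lemma avoids_after_insert_above:
  assumes "M < c" "\<forall>x\<in>S. c < x"
  shows "avoids_after M (insert c S # B) \<longleftrightarrow> avoids_after c (S # B)"
  using assms avoids_after_mono[of c B M] by (fastforce simp: avoids_after_Cons)

section \<open>Removing the least element of the first block\<close>

text \<open>The ways to finish an avoiding ordered partition when the set \<open>R\<close> remains to be distributed into
\<open>k\<close> further blocks, \<open>M\<close> is the largest element placed so far, and no two placed elements form a
descent above an element of \<open>R\<close>.\<close>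

definition completions :: "nat set \<Rightarrow> nat \<Rightarrow> nat \<Rightarrow> nat set list set" where
  "completions R M k = {B. block_list R B \<and> length B = k \<and> avoids_after M B}"

lemma finite_completions: "finite R \<Longrightarrow> finite (completions R M k)"
proof (rule finite_subset)
  show "completions R M k \<subseteq> {B. set B \<subseteq> Pow R \<and> length B = k}"
    using block_list_Union by (fastforce simp: completions_def)
  show "finite R \<Longrightarrow> finite {B. set B \<subseteq> Pow R \<and> length B = k}"
    by (rule finite_lists_length_eq) simp
qed

lemma completions_empty: "completions {} M k = (if k = 0 then {[]} else {})"
proof -
  have *: "block_list {} B \<longleftrightarrow> B = []" for B by (cases B) auto
  show ?thesis unfolding completions_def * by (rule set_eqI) auto
qed

lemma completions_0: "R \<noteq> {} \<Longrightarrow> completions R M 0 = {}"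
  by (auto simp: completions_def)

definition completions_min :: "nat set \<Rightarrow> nat \<Rightarrow> nat \<Rightarrow> nat \<Rightarrow> nat set list set" where
  "completions_min R M k c = {B \<in> completions R M (Suc k). Min (hd B) = c}"

lemma completions_hd:
  assumes "finite R" "B \<in> completions R M (Suc k)"
  obtains S T where "B = S # T" "S \<noteq> {}" "finite S" "S \<subseteq> R" "Min S \<in> R" "Min S \<in> S"
    "block_list (R - S) T" "length T = k"
proof -
  obtain S T where B: "B = S # T" using assms(2) by (cases B) (auto simp: completions_def)
  then have "S \<noteq> {}" "S \<subseteq> R" "block_list (R - S) T" "length T = k"
    using assms(2) by (auto simp: completions_def)
  moreover have "finite S" using \<open>S \<subseteq> R\<close> assms(1) finite_subset by blast
  moreover have "Min S \<in> S" using calculation by simp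
  ultimately show ?thesis using that[OF B] by blast
qed

lemma card_completions_Suc:
  assumes "finite R"
  shows "card (completions R M (Suc k)) = (\<Sum>c\<in>R. card (completions_min R M k c))"
proof -
  have "completions R M (Suc k) = (\<Union>c\<in>R. completions_min R M k c)"
  proof (intro set_eqI iffI)
    fix B assume B: "B \<in> completions R M (Suc k)"
    obtain S T where "B = S # T" "Min S \<in> R"
      using completions_hd[OF assms B] by metis
    then show "B \<in> (\<Union>c\<in>R. completions_min R M k c)"
      using B by (auto simp: completions_min_def)
  qed (auto simp: completions_min_def)
  moreover have "card (\<Union>c\<in>R. completions_min R M k c) = (\<Sum>c\<in>R. card (completions_min R M k c))"
    using assms finite_completions[OF assms]
    by (intro card_UN_disjoint) (auto simp: completions_min_def)
  ultimately show ?thesis by simp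
qed

text \<open>If the first block starts with \<open>c < M\<close> and a smaller element is still to come, then \<open>M\<close>, \<open>c\<close>
and that element form the pattern 321.\<close>

lemma completions_min_below:
  assumes "finite R" "c \<in> R" "c < M" "c \<noteq> Min R"
  shows "completions_min R M k c = {}"
proof (rule ccontr)
  assume "completions_min R M k c \<noteq> {}"
  then obtain B where B: "B \<in> completions R M (Suc k)" "Min (hd B) = c"
    by (auto simp: completions_min_def)
  obtain S T where ST: "B = S # T" "S \<noteq> {}" "finite S" "S \<subseteq> R" "Min S \<in> S" "block_list (R - S) T"
    using completions_hd[OF assms(1) B(1)] by metis
  have m: "Min R \<in> R" "Min R < c" using assms
    by (auto intro!: Min_in simp: order.not_eq_order_implies_strict)
  then have "Min R \<notin> S" using ST B(2) by (metis Min_le list.sel(1) not_le)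
  then have "Min R \<in> \<Union>(set T)" using m block_list_Union[OF ST(6)] by blast
  moreover have "avoids_after M (S # T)" "c \<in> S" using B ST by (auto simp: completions_def)
  ultimately show False using m(2) assms(3) by (metis avoids_after_Cons not_le)
qed

text \<open>Removing \<open>c\<close> either deletes the whole first block or leaves a nonempty block, all of whose elements
exceed \<open>c\<close>. Conversely \<open>c\<close> can be put back as a block of its own, or glued to a first block whose
minimum is larger.\<close>

lemma card_completions_min:
  assumes R: "finite R" "c \<in> R" and M: "M \<notin> R" and c: "c < M \<longrightarrow> c = Min R"
  shows "card (completions_min R M k c) =
    card (completions (R - {c}) (max c M) k) +
    card {B \<in> completions (R - {c}) (max c M) (Suc k). c < Min (hd B)}"
proof -
  let ?P = "completions (R - {c}) (max c M) k"
  let ?Q = "{B \<in> completions (R - {c}) (max c M) (Suc k). c < Min (hd B)}"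
  let ?f = "\<lambda>B. insert c (hd B) # tl B"
  have fR: "finite (R - {c})" using R by simp
  have key: "avoids_after M (insert c S # T) \<longleftrightarrow> avoids_after (max c M) (S # T)"
    if "\<Union>(set T) \<subseteq> R" "\<forall>x\<in>S. c < x" for S T
  proof (cases "c < M")
    case True
    then have "\<forall>x\<in>\<Union>(set T). c \<le> x" using c R that by auto
    then show ?thesis using True by (simp add: avoids_after_insert_below max_def)
  next
    case False
    then have "M < c" using M R by (metis linorder_neqE_nat)
    then show ?thesis using that by (simp add: avoids_after_insert_above max_def)
  qed
  \<comment> \<open>An empty first block imposes nothing, so \<open>S = {}\<close> covers the deletion of a whole block.\<close>
  have key0: "avoids_after M ({c} # T) \<longleftrightarrow> avoids_after (max c M) T"
    if "\<Union>(set T) \<subseteq> R" for T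
    using key[of T "{}"] that by (simp add: avoids_after_Cons)
  have 1: "{B \<in> completions_min R M k c. hd B = {c}} = (\<lambda>T. {c} # T) ` ?P" (is "?A = ?B")
  proof (intro set_eqI iffI)
    fix B assume "B \<in> ?A"
    then have B: "B \<in> completions R M (Suc k)" "hd B = {c}" by (auto simp: completions_min_def)
    then obtain T where T: "B = {c} # T" by (cases B) (auto simp: completions_def)
    then have "\<Union>(set T) \<subseteq> R"
      using B block_list_Union[of "R - {c}" T] by (auto simp: completions_def)
    then have "T \<in> ?P" using B T key0 by (auto simp: completions_def)
    then show "B \<in> ?B" using T by auto
  next
    fix B assume "B \<in> ?B"
    then obtain T where T: "B = {c} # T" "T \<in> ?P" by auto
    then have "\<Union>(set T) \<subseteq> R"
      using block_list_Union[of "R - {c}" T] by (auto simp: completions_def)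
    then show "B \<in> ?A" using T key0 R by (auto simp: completions_def completions_min_def)
  qed
  have 2: "{B \<in> completions_min R M k c. hd B \<noteq> {c}} = ?f ` ?Q" (is "?A = ?B")
  proof (intro set_eqI iffI)
    fix B assume "B \<in> ?A"
    then have B: "B \<in> completions R M (Suc k)" "hd B \<noteq> {c}" "Min (hd B) = c"
      by (auto simp: completions_min_def)
    obtain S T where ST: "B = S # T" "S \<noteq> {}" "finite S" "S \<subseteq> R" "Min S \<in> S"
        "block_list (R - S) T" "length T = k"
      using completions_hd[OF R(1) B(1)] by metis
    define S' where "S' = S - {c}"
    have "c \<in> S" using ST(1,5) B(3) by simp
    then have S': "S = insert c S'" "c \<notin> S'" by (auto simp: S'_def)
    then have ne: "S' \<noteq> {}" using ST B by auto
    have gt: "\<forall>x\<in>S'. c < x"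
    proof
      fix x assume x: "x \<in> S'"
      then have "Min S \<le> x" using ST(3) by (simp add: S'_def)
      then show "c < x" using x S'(2) ST(1) B(3) by (cases "x = c") auto
    qed
    have "\<Union>(set T) \<subseteq> R" using block_list_Union[OF ST(6)] by auto
    then have "avoids_after (max c M) (S' # T)"
      using key[of T S'] gt B(1) ST(1) S'(1) by (simp add: completions_def)
    moreover have "R - {c} - S' = R - S" using S' by auto
    ultimately have "S' # T \<in> completions (R - {c}) (max c M) (Suc k)"
      using ST S' ne by (auto simp: completions_def)
    moreover have "c < Min S'" using gt ne ST(3) by (simp add: S'_def)
    ultimately have "S' # T \<in> ?Q" by simp
    moreover have "B = ?f (S' # T)" using ST S' by simp
    ultimately show "B \<in> ?B" by blast
  next
    fix B assume "B \<in> ?B"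
    then obtain C where C: "C \<in> ?Q" "B = ?f C" by auto
    then have C': "C \<in> completions (R - {c}) (max c M) (Suc k)" "c < Min (hd C)" by auto
    obtain S T where ST: "C = S # T" "S \<noteq> {}" "finite S" "S \<subseteq> R - {c}" "Min S \<in> S"
        "block_list (R - {c} - S) T" "length T = k"
      using completions_hd[OF fR C'(1)] by metis
    have gt: "\<forall>x\<in>S. c < x" using C'(2) ST by auto
    have "R - {c} - S = R - insert c S" by auto
    then have "block_list (R - insert c S) T" using ST(6) by simp
    moreover have "insert c S \<subseteq> R" using ST(4) R(2) by auto
    moreover have "\<Union>(set T) \<subseteq> R" using block_list_Union[OF ST(6)] by auto
    then have "avoids_after M (insert c S # T)"
      using key[of T S] gt C'(1) ST(1) by (simp add: completions_def)
    moreover have "Min (insert c S) = c" using ST gt by (simp add: Min_insert2 less_imp_le)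
    moreover have "insert c S \<noteq> {c}" using ST by auto
    moreover have "B = insert c S # T" using C(2) ST(1) by simp
    ultimately show "B \<in> ?A"
      using ST(7) by (simp add: completions_def completions_min_def)
  qed
  have "inj_on ?f ?Q"
  proof (rule inj_onI)
    fix B C assume BC: "B \<in> ?Q" "C \<in> ?Q" "?f B = ?f C"
    obtain S T where B: "B = S # T" "c \<notin> S" using BC(1) by (cases B) (auto simp: completions_def)
    obtain S' T' where C: "C = S' # T'" "c \<notin> S'" using BC(2) by (cases C) (auto simp: completions_def)
    show "B = C" using BC(3) B C by (simp add: insert_ident)
  qed
  then have "card (?f ` ?Q) = card ?Q" by (rule card_image)
  moreover have "card ((\<lambda>T. {c} # T) ` ?P) = card ?P" by (rule card_image) (simp add: inj_on_def)
  moreover have "card (completions_min R M k c) =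
     card ({B \<in> completions_min R M k c. hd B = {c}} \<union> {B \<in> completions_min R M k c. hd B \<noteq> {c}})"
    by (rule arg_cong[of _ _ card]) auto
  moreover have "finite (completions_min R M k c)"
    using finite_completions[OF R(1)] by (simp add: completions_min_def)
  then have "card ({B \<in> completions_min R M k c. hd B = {c}} \<union> {B \<in> completions_min R M k c. hd B \<noteq> {c}}) =
     card {B \<in> completions_min R M k c. hd B = {c}} + card {B \<in> completions_min R M k c. hd B \<noteq> {c}}"
    by (intro card_Un_disjoint) auto
  ultimately show ?thesis unfolding 1 2 by simp
qed

text \<open>The number of completions that open \<open>k\<close> new blocks when the first part of the completion is also
allowed to be glued to the preceding block: glued completions have \<open>k + 1\<close> parts.\<close>

definition merged_count :: "nat set \<Rightarrow> nat \<Rightarrow> nat \<Rightarrow> int" where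
  "merged_count R M k = int (card (completions R M k)) + int (card (completions R M (Suc k)))"

text \<open>When the removed element is the least one remaining, the rest can always be glued to it.\<close>

lemma card_completions_min_Min:
  assumes R: "finite R" "R \<noteq> {}" and M: "Min R < M"  "M \<notin> R"
  shows "int (card (completions_min R M k (Min R))) = merged_count (R - {Min R}) M k"
proof -
  have fR: "finite (R - {Min R})" using R by simp
  have "{B \<in> completions (R - {Min R}) M (Suc k). Min R < Min (hd B)} =
      completions (R - {Min R}) M (Suc k)"
  proof (intro set_eqI iffI)
    fix B assume B: "B \<in> completions (R - {Min R}) M (Suc k)"
    obtain S T where "B = S # T" "Min S \<in> R - {Min R}"
      using completions_hd[OF fR B] by metis
    then have "Min R < Min (hd B)" using Min_le[OF R(1), of "Min S"] by auto
    then show "B \<in> {B \<in> completions (R - {Min R}) M (Suc k). Min R < Min (hd B)}" using B by simp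
  qed simp
  then show ?thesis
    using card_completions_min[of R "Min R" M k] R M by (simp add: merged_count_def max_def)
qed

text \<open>After a new maximum \<open>c\<close>, gluing fails exactly if the next block starts below \<open>c\<close>. By
\<open>completions_min_below\<close> that block then starts with the least remaining element, so the failures are
themselves counted by \<open>merged_count\<close>, with one more element removed.\<close>

lemma card_completions_min_above:
  assumes R: "finite R" "c \<in> R" and M: "M < c" "M \<notin> R"
  shows "int (card (completions_min R M k c)) = merged_count (R - {c}) c k -
    (if c = Min R then 0 else merged_count (R - {c} - {Min R}) c k)"
proof -
  let ?A = "completions (R - {c}) c (Suc k)"
  have fR: "finite (R - {c})" using R by simp
  note Rmin = Min_in[OF R(1)] Min_le[OF R(1)]
  have fA: "finite ?A" using finite_completions[OF fR] .
  have "?A = {B \<in> ?A. c < Min (hd B)} \<union> {B \<in> ?A. Min (hd B) < c}"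
  proof (intro set_eqI iffI)
    fix B assume B: "B \<in> ?A"
    obtain S T where "B = S # T" "Min S \<in> R - {c}"
      using completions_hd[OF fR B] by metis
    then show "B \<in> {B \<in> ?A. c < Min (hd B)} \<union> {B \<in> ?A. Min (hd B) < c}"
      using B by auto
  qed auto
  then have "card ?A = card ({B \<in> ?A. c < Min (hd B)} \<union> {B \<in> ?A. Min (hd B) < c})"
    by (rule arg_cong)
  also have "\<dots> = card {B \<in> ?A. c < Min (hd B)} + card {B \<in> ?A. Min (hd B) < c}"
    using fA by (intro card_Un_disjoint) auto
  finally have split: "card ?A = card {B \<in> ?A. c < Min (hd B)} + card {B \<in> ?A. Min (hd B) < c}" .
  have low: "int (card {B \<in> ?A. Min (hd B) < c}) =
      (if c = Min R then 0 else merged_count (R - {c} - {Min R}) c k)"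
  proof (cases "c = Min R")
    case True
    have "{B \<in> ?A. Min (hd B) < c} = {}"
    proof (rule ccontr)
      assume "{B \<in> ?A. Min (hd B) < c} \<noteq> {}"
      then obtain B where B: "B \<in> ?A" "Min (hd B) < c" by blast
      obtain S T where "B = S # T" "Min S \<in> R - {c}"
        using completions_hd[OF fR B(1)] by metis
      then show False using B(2) True Rmin(2)[of "Min S"] by auto
    qed
    then show ?thesis using True by (simp only: card.empty) simp
  next
    case False
    then have lt: "Min R < c" using Rmin(2)[OF R(2)] by simp
    have mem: "Min R \<in> R - {c}" using Rmin(1) R(2) False by auto
    have m: "Min (R - {c}) = Min R"
      using mem Rmin(2) fR by (intro Min_eqI) auto
    have "{B \<in> ?A. Min (hd B) < c} = completions_min (R - {c}) c k (Min R)"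
    proof (intro set_eqI iffI)
      fix B assume "B \<in> {B \<in> ?A. Min (hd B) < c}"
      then have B: "B \<in> ?A" "Min (hd B) < c" by auto
      have Bm: "B \<in> completions_min (R - {c}) c k (Min (hd B))"
        using B by (simp add: completions_min_def)
      obtain S T where "B = S # T" "Min S \<in> R - {c}"
        using completions_hd[OF fR B(1)] by metis
      then have "Min (hd B) \<in> R - {c}" by simp
      then have "Min (hd B) = Min (R - {c})"
        using completions_min_below[OF fR, of "Min (hd B)" c k] B(2) Bm by blast
      then show "B \<in> completions_min (R - {c}) c k (Min R)" using Bm m by simp
    qed (use lt in \<open>auto simp: completions_min_def\<close>)
    then show ?thesis
      using card_completions_min_Min[OF fR, of c k] mem m lt False by auto
  qed
  have "int (card (completions_min R M k c)) =
      int (card (completions (R - {c}) c k)) + int (card {B \<in> ?A. c < Min (hd B)})"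
    using card_completions_min[OF R M(2)] M(1) by (simp add: max_def)
  then show ?thesis using split low by (simp add: merged_count_def)
qed

section \<open>Solving the counting recurrence\<close>

lemma bij_betw_rank:
  assumes "finite R"
  shows "bij_betw (\<lambda>c. card {r \<in> R. r < c}) {c \<in> R. (M::nat) \<le> c} {card {r \<in> R. r < M}..<card R}"
proof -
  let ?f = "\<lambda>c. card {r \<in> R. r < c}" and ?A = "{c \<in> R. M \<le> c}"
  have lt: "?f c < ?f d" if "c \<in> R" "c < d" for c d
    using assms that by (intro psubset_card_mono) auto
  have inj: "inj_on ?f ?A"
    by (rule inj_onI) (metis (no_types, lifting) lt linorder_neqE_nat less_irrefl mem_Collect_eq)
  have sub: "?f ` ?A \<subseteq> {?f M..<card R}"
  proof -
    have "?f c < card R" if "c \<in> R" for c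
      using assms that by (intro psubset_card_mono) auto
    moreover have "?f M \<le> ?f c" if "M \<le> c" for c
      using assms that by (intro card_mono) auto
    ultimately show ?thesis by auto
  qed
  have "card R = ?f M + card ?A"
    using assms by (subst card_Un_disjoint[symmetric]) (auto intro!: arg_cong[of _ _ card])
  then have "card (?f ` ?A) = card {?f M..<card R}" using card_image[OF inj] by simp
  then have "?f ` ?A = {?f M..<card R}" using sub by (intro card_subset_eq) auto
  then show ?thesis using inj by (simp add: bij_betw_def)
qed

text \<open>The first block starts either with \<open>Min R\<close>, if this is below \<open>M\<close>, or with any element above \<open>M\<close>.
The negative terms are the failed gluings of \<open>card_completions_min_above\<close>.\<close>

lemma card_completions_recurrence:
  assumes R: "finite R" "R \<noteq> {}" and M: "M \<notin> R"
  shows "int (card (completions R M (Suc k))) =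
    (if Min R < M then merged_count (R - {Min R}) M k else 0) +
    (\<Sum>c | c \<in> R \<and> M \<le> c. merged_count (R - {c}) c k -
       (if c = Min R then 0 else merged_count (R - {c} - {Min R}) c k))"
proof -
  let ?g = "\<lambda>c. int (card (completions_min R M k c))"
  have "int (card (completions R M (Suc k))) = (\<Sum>c\<in>R. ?g c)"
    by (simp add: card_completions_Suc[OF R(1)])
  also have "\<dots> = (\<Sum>c | c \<in> R \<and> c < M. ?g c) + (\<Sum>c | c \<in> R \<and> M \<le> c. ?g c)"
    using R by (subst sum.union_disjoint[symmetric]) (auto intro!: sum.cong)
  finally have split: "int (card (completions R M (Suc k))) =
    (\<Sum>c | c \<in> R \<and> c < M. ?g c) + (\<Sum>c | c \<in> R \<and> M \<le> c. ?g c)" .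
  have below: "(\<Sum>c | c \<in> R \<and> c < M. ?g c) =
      (if Min R < M then merged_count (R - {Min R}) M k else 0)"
  proof (cases "Min R < M")
    case True
    have "(\<Sum>c | c \<in> R \<and> c < M. ?g c) = (\<Sum>c \<in> {Min R}. ?g c)"
      using R True completions_min_below[OF R(1)] by (intro sum.mono_neutral_right) auto
    then show ?thesis using card_completions_min_Min[OF R True M] True by simp
  next
    case False
    then have "{c. c \<in> R \<and> c < M} = {}"
      using Min_le[OF R(1)] by (auto simp: not_less dest: order_trans)
    then show ?thesis using False by (simp only: sum.empty if_False)
  qed
  have above: "(\<Sum>c | c \<in> R \<and> M \<le> c. ?g c) = (\<Sum>c | c \<in> R \<and> M \<le> c. merged_count (R - {c}) c k -
       (if c = Min R then 0 else merged_count (R - {c} - {Min R}) c k))"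
  proof (rule sum.cong[OF refl])
    fix c assume "c \<in> {c. c \<in> R \<and> M \<le> c}"
    then have "c \<in> R" "M < c" using M by (auto intro: le_neq_trans)
    then show "?g c = merged_count (R - {c}) c k -
       (if c = Min R then 0 else merged_count (R - {c} - {Min R}) c k)"
      using card_completions_min_above[OF R(1) _ _ M] by blast
  qed
  show ?thesis unfolding split below above ..
qed

text \<open>Closed forms for a set of \<open>n\<close> elements, \<open>u\<close> of them below the current maximum: \<open>merged_formula\<close>
for \<open>merged_count\<close>, \<open>fresh_formula\<close> for the completions with \<open>k + 1\<close> blocks. As series in $x$ and
$t$, with $b_m(u)$ the ballot numbers, they are $\sum_m (x - x^2)^m (1 + t)^m b_m(u)$ and, for
\<open>n > 0\<close>, $\sum_m (x - x^2)^{m+1} (1 + t)^m b_{m+1}(u)$.\<close>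

definition merged_formula :: "nat \<Rightarrow> nat \<Rightarrow> nat \<Rightarrow> int" where
  "merged_formula n u k = (\<Sum>m\<le>n. int (m choose k) * quad_coeff m (int n) * int (ballot m u))"

definition fresh_formula :: "nat \<Rightarrow> nat \<Rightarrow> nat \<Rightarrow> int" where
  "fresh_formula n u k =
     (\<Sum>m<n. int (m choose k) * quad_coeff (Suc m) (int n) * int (ballot (Suc m) u))"

lemma sum_ballot:
  assumes "m < N"
  shows "(\<Sum>r = u - 1..<N. ballot m r) = ballot (Suc m) u"
proof -
  have "(\<Sum>r = u - 1..<N. ballot m r) = (\<Sum>r = u - 1..m. ballot m r)"
    using assms by (intro sum.mono_neutral_right) (auto simp: ballot_eq_0)
  then show ?thesis by simp
qed

lemma sum_merged_formula:
  assumes "p < N"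
  shows "(\<Sum>r = u - 1..<N. merged_formula p r k) =
    (\<Sum>m\<le>p. int (m choose k) * quad_coeff m (int p) * int (ballot (Suc m) u))"
proof -
  have "(\<Sum>r = u - 1..<N. merged_formula p r k) =
    (\<Sum>m\<le>p. int (m choose k) * quad_coeff m (int p) * (\<Sum>r = u - 1..<N. int (ballot m r)))"
    unfolding merged_formula_def sum_distrib_left by (rule sum.swap)
  also have "\<dots> = (\<Sum>m\<le>p. int (m choose k) * quad_coeff m (int p) * int (ballot (Suc m) u))"
    using assms by (intro sum.cong) (simp_all add: sum_ballot[unfolded One_nat_def] del: ballot.simps flip: of_nat_sum)
  finally show ?thesis .
qed

text \<open>Summation over \<open>r\<close> advances the ballot numbers by one row, and the difference of the levels \<open>n\<close> and
\<open>n - 1\<close> multiplies by $x - x^2$. For \<open>n = 0\<close> the second sum is empty, so the truncated \<open>n - 1\<close> does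
no harm.\<close>

lemma sum_merged_formula_diff:
  "(\<Sum>r = u - 1..<Suc n. merged_formula n r k) - (\<Sum>r = u - 1..<n. merged_formula (n - 1) r k)
   = fresh_formula (Suc n) u k"
proof -
  let ?w = "\<lambda>m. int (m choose k)" and ?K = "\<lambda>m. int (ballot (Suc m) u)"
  have second: "(\<Sum>r = u - 1..<n. merged_formula (n - 1) r k) =
      (\<Sum>m\<le>n. ?w m * quad_coeff m (int n - 1) * ?K m)"
  proof (cases n)
    case 0
    then show ?thesis by simp
  next
    case (Suc p)
    then show ?thesis
      using sum_merged_formula[of p n k u]
      by (simp add: quad_coeff_eq_0 del: ballot.simps sum.op_ivl_Suc)
  qed
  show ?thesis
    unfolding second sum_merged_formula[OF lessI] fresh_formula_def lessThan_Suc_atMost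
    by (simp add: sum_subtractf[symmetric] algebra_simps del: ballot.simps)
qed

lemma merged_formula_Suc:
  "merged_formula (Suc n) u k =
     fresh_formula (Suc n) u k + (if k = 0 then 0 else fresh_formula (Suc n) u (k - 1))"
proof -
  have "merged_formula (Suc n) u k =
    (\<Sum>m\<le>n. int (Suc m choose k) * quad_coeff (Suc m) (int (Suc n)) * int (ballot (Suc m) u))"
    unfolding merged_formula_def by (subst sum.atMost_Suc_shift) simp
  also have "\<dots> = fresh_formula (Suc n) u k + (if k = 0 then 0 else fresh_formula (Suc n) u (k - 1))"
    unfolding fresh_formula_def lessThan_Suc_atMost
    by (cases k) (simp_all del: ballot.simps quad_coeff.simps add: algebra_simps sum.distrib)
  finally show ?thesis .
qed

lemma rank_diff:
  assumes "finite R" "x \<in> R" "x < c"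
  shows "card {r \<in> R - {x}. r < c} = card {r \<in> R. r < c} - 1"
proof -
  have "{r \<in> R - {x}. r < c} = {r \<in> R. r < c} - {x}" by auto
  then show ?thesis using assms by simp
qed

text \<open>In terms of ranks, the recurrence becomes
$\sum_{r \ge u-1} (L_{n}(r) - L_{n-1}(r))$ with $L$ the formula for the merged count and
\<open>n = card R - 1\<close>: the element \<open>Min R\<close> supplies the term \<open>r = u - 1\<close>, and each failed gluing at rank \<open>r\<close>
contributes to rank \<open>r - 1\<close>. The lemma is the step of the induction in \<open>merged_count_eq\<close>.\<close>

lemma card_completions_eq:
  assumes "finite R" "M \<notin> R" "R \<noteq> {}"
    and merged: "\<And>R' M' k. finite R' \<Longrightarrow> M' \<notin> R' \<Longrightarrow> card R' < card R \<Longrightarrow>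
      merged_count R' M' k = merged_formula (card R') (card {r \<in> R'. r < M'}) k"
  shows "int (card (completions R M (Suc k))) = fresh_formula (card R) (card {r \<in> R. r < M}) k"
proof -
  let ?rank = "\<lambda>c. card {r \<in> R. r < c}"
  define n where "n = card R - 1"
  have cR: "card R = Suc n" using assms by (simp add: n_def card_gt_0_iff)
  have minR: "Min R \<in> R" "\<And>x. x \<in> R \<Longrightarrow> Min R \<le> x" using assms by auto
  have Min_less: "Min R < c \<longleftrightarrow> 0 < ?rank c" for c
    using assms(1) minR(1) le_less_trans[OF minR(2)] by (auto simp: card_gt_0_iff)
  let ?u = "?rank M"
  \<comment> \<open>The contribution of a new maximum of rank \<open>r\<close>; at rank 0 no gluing can fail.\<close>
  let ?h = "\<lambda>r. merged_formula n r k - (if r = 0 then 0 else merged_formula (n - 1) (r - 1) k)"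
  have first: "(if Min R < M then merged_count (R - {Min R}) M k else 0) =
      (if ?u = 0 then 0 else merged_formula n (?u - 1) k)"
  proof (cases "Min R < M")
    case True
    have "merged_count (R - {Min R}) M k = merged_formula n (?u - 1) k"
      using merged[of "R - {Min R}" M k] rank_diff[OF assms(1) minR(1) True] assms(1,2) minR(1) cR
      by simp
    moreover have "?u \<noteq> 0" using iffD1[OF Min_less True] by (rule gr_implies_not0)
    ultimately show ?thesis using True by (simp only: if_True if_False)
  next
    case False
    then have "?u = 0" using Min_less[of M] by blast
    then show ?thesis using False by (simp only: if_True if_False refl)
  qed
  have placed: "merged_count (R - {c}) c k -
       (if c = Min R then 0 else merged_count (R - {c} - {Min R}) c k) = ?h (?rank c)"
    if c: "c \<in> R" for c
  proof -
    have e: "card {r \<in> R. r \<noteq> c \<and> r < c} = ?rank c" by (rule arg_cong[of _ _ card]) auto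
    have 1: "merged_count (R - {c}) c k = merged_formula n (?rank c) k"
      using merged[of "R - {c}" c k] c cR assms(1) by (simp add: e)
    show ?thesis
    proof (cases "c = Min R")
      case True
      then have "?rank c = 0" using Min_less[of c] by simp
      then show ?thesis using 1 True by simp
    next
      case False
      then have lt: "Min R < c" using minR(2)[OF c] by simp
      have mem: "Min R \<in> R - {c}" using False minR by auto
      have "card (R - {c} - {Min R}) = n - 1"
        using mem assms(1) c cR by (simp add: card_Diff_singleton)
      moreover have "card {r \<in> R - {c} - {Min R}. r < c} = ?rank c - 1"
        using rank_diff[of "R - {c}" "Min R" c] mem lt assms(1) by (simp add: e)
      ultimately have "merged_count (R - {c} - {Min R}) c k = merged_formula (n - 1) (?rank c - 1) k"
        using merged[of "R - {c} - {Min R}" c k] assms(1) cR by simp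
      moreover have "?rank c \<noteq> 0" using iffD1[OF Min_less lt] by (rule gr_implies_not0)
      ultimately show ?thesis using 1 False by (simp only: if_False)
    qed
  qed
  have "(\<Sum>c | c \<in> R \<and> M \<le> c. merged_count (R - {c}) c k -
       (if c = Min R then 0 else merged_count (R - {c} - {Min R}) c k))
     = (\<Sum>c\<in>{c \<in> R. M \<le> c}. ?h (?rank c))"
    by (rule sum.cong) (auto simp: placed)
  also have "\<dots> = (\<Sum>r = ?u..<Suc n. ?h r)"
    using sum.reindex_bij_betw[OF bij_betw_rank[OF assms(1), of M], of ?h] cR by simp
  finally have second: "(\<Sum>c | c \<in> R \<and> M \<le> c. merged_count (R - {c}) c k -
       (if c = Min R then 0 else merged_count (R - {c} - {Min R}) c k))
     = (\<Sum>r = ?u..<Suc n. ?h r)" .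
  have u: "?u \<le> Suc n" using assms(1) cR by (metis (no_types, lifting) card_mono mem_Collect_eq subsetI)
  have collect: "(if v = 0 then 0 else merged_formula n (v - 1) k) + (\<Sum>r = v..<Suc n. ?h r) =
      (\<Sum>r = v - 1..<Suc n. merged_formula n r k) - (\<Sum>r = v - 1..<n. merged_formula (n - 1) r k)"
    if "v \<le> Suc n" for v
  proof (cases v)
    case 0
    have "(\<Sum>r = 0..<Suc n. ?h r) = (\<Sum>r = 0..<Suc n. merged_formula n r k) -
        (\<Sum>r = 0..<Suc n. if r = 0 then 0 else merged_formula (n - 1) (r - 1) k)"
      by (rule sum_subtractf)
    also have "(\<Sum>r = 0..<Suc n. if r = 0 then 0 else merged_formula (n - 1) (r - 1) k) =
        (\<Sum>r = 0..<n. merged_formula (n - 1) r k)"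
      by (subst sum.atLeast0_lessThan_Suc_shift) simp
    finally show ?thesis using 0 by simp
  next
    case (Suc w)
    have "(\<Sum>r = v..<Suc n. ?h r) = (\<Sum>r = Suc w..<Suc n. merged_formula n r k) -
        (\<Sum>r = Suc w..<Suc n. merged_formula (n - 1) (r - 1) k)"
      unfolding Suc sum_subtractf[symmetric] by (rule sum.cong) auto
    also have "(\<Sum>r = Suc w..<Suc n. merged_formula (n - 1) (r - 1) k) =
        (\<Sum>r = w..<n. merged_formula (n - 1) r k)"
      by (simp add: sum.shift_bounds_Suc_ivl del: sum.op_ivl_Suc)
    finally show ?thesis
      using Suc that by (simp add: sum.atLeast_Suc_lessThan[of w "Suc n"] del: sum.op_ivl_Suc)
  qed
  show ?thesis
    unfolding card_completions_recurrence[OF assms(1,3,2)] first second collect[OF u]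
      sum_merged_formula_diff cR ..
qed

lemma merged_count_eq:
  assumes "finite R" "M \<notin> R"
  shows "merged_count R M k = merged_formula (card R) (card {r \<in> R. r < M}) k"
  using assms
proof (induction "card R" arbitrary: R M k rule: less_induct)
  case less
  show ?case
  proof (cases "R = {}")
    case True
    then show ?thesis
      by (cases k) (auto simp: merged_count_def merged_formula_def completions_empty)
  next
    case False
    have fresh: "int (card (completions R M (Suc k))) =
        fresh_formula (card R) (card {r \<in> R. r < M}) k" for k
      using card_completions_eq[OF less.prems False] less.hyps by blast
    obtain n where n: "card R = Suc n"
      using False less.prems(1) by (metis card_gt_0_iff gr0_implies_Suc)
    show ?thesis
      using fresh[of k] fresh[of "k - 1"] completions_0[OF False, of M]
      unfolding n merged_formula_Suc by (cases k) (auto simp: merged_count_def)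
  qed
qed

section \<open>The recurrences\<close>

lemma op_321_eq_sum_nonneg:
  assumes "0 \<le> n" "n \<le> int N"
  shows "op_321 n (int k) = (\<Sum>m\<le>N. quad_coeff m n * op_coeff m k)"
proof -
  define p where "p = nat n"
  have n: "n = int p" using assms by (simp add: p_def)
  have trim: "(\<Sum>m\<le>N. quad_coeff m n * op_coeff m k) = (\<Sum>m\<le>p. quad_coeff m n * op_coeff m k)"
    using assms n by (intro sum.mono_neutral_right) (auto simp: quad_coeff_eq_0)
  consider (empty) "p = 0" | (pos) q j where "p = Suc q" "k = Suc j" | (zero) "p \<noteq> 0" "k = 0"
    by (cases p; cases k) auto
  then show ?thesis
  proof cases
    case empty
    then show ?thesis unfolding trim using n by (cases k) (auto simp: op_321_def)
  next
    case zero
    have "(\<Sum>m\<le>p. quad_coeff m n * op_coeff m k) = 0"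
      using zero n by (intro sum.neutral) (auto simp: op_coeff_def)
    then show ?thesis unfolding trim using n zero by (auto simp: op_321_def)
  next
    case pos
    have shape: "(\<Sum>m\<le>p. quad_coeff m n * op_coeff m k) = fresh_formula p 0 j"
      unfolding pos(1) fresh_formula_def lessThan_Suc_atMost
      by (subst sum.atMost_Suc_shift)
        (simp add: n pos mult_ac del: ballot.simps quad_coeff.simps(2))
    show ?thesis
    proof (cases "k \<le> p")
      case True
      have "card (completions {1..p} 0 (Suc j)) =
          card {B. ordered_partition p k B \<and> \<not> contains_321 B}"
        using pos by (intro arg_cong[of _ _ card])
          (auto simp: completions_def ordered_partition_iff_block_list avoids_after_0)
      moreover have "int (card (completions {1..p} 0 (Suc j))) = fresh_formula p 0 j"
        using card_completions_eq[of "{1..p}" 0 j] merged_count_eq pos by auto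
      ultimately show ?thesis unfolding trim shape using n True pos
        by (simp add: op_321_def del: of_nat_Suc)
    next
      case False
      then have "fresh_formula p 0 j = 0"
        using pos unfolding fresh_formula_def by (intro sum.neutral) auto
      then show ?thesis unfolding trim shape using n False by (simp add: op_321_def)
    qed
  qed
qed

text \<open>The generating function is $1 + \sum_{m \ge 1} C_m (x - x^2)^m t (1 + t)^{m-1}$. Any upper bound
\<open>N \<ge> n\<close> for the summation is admitted, so that the different values of \<open>n\<close> in a recurrence can
share one index set.\<close>

lemma op_321_eq_sum:
  assumes "n \<le> int N"
  shows "op_321 n (int k) = (\<Sum>m\<le>N. quad_coeff m n * op_coeff m k)"
proof (cases "0 \<le> n")
  case False
  then have "(\<Sum>m\<le>N. quad_coeff m n * op_coeff m k) = 0"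
    by (intro sum.neutral) (auto simp: quad_coeff_eq_0)
  then show ?thesis using False by (auto simp: op_321_def)
qed (use assms op_321_eq_sum_nonneg in blast)

text \<open>Let $y = x - x^2$ and let $\theta = x\,\frac{d}{dx}$. The claim is the part with positive powers of
$t$ of $(\theta + 1)((1-x) F) = (1 + t)\,y\,(4\theta((1-x) F) + 2F)$. On $F = y^m$ the left-hand
side is $(m+1)(1-2x)\,y^m$ and the right-hand side is $(1 + t)(4m+2)(1-2x)\,y^{m+1}$, so the claim
reduces to \<open>op_coeff_Suc_left\<close>.\<close>

lemma op_321_rec_n:
  "(n + 4) * op_321 (n + 3) (int k + 1) =
     (5 * n + 14) * op_321 (n + 2) (int k + 1) + (4 * n + 10) * op_321 (n + 2) (int k)
     - (8 * n + 14) * (op_321 (n + 1) (int k + 1) + op_321 (n + 1) (int k))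
     + (4 * n + 4) * (op_321 n (int k + 1) + op_321 n (int k))"
proof -
  define N where "N = nat (n + 3)"
  let ?q = "\<lambda>m. quad_coeff m"
  let ?a = "\<lambda>m. op_coeff m (Suc k)" and ?b = "\<lambda>m. op_coeff m k"
  \<comment> \<open>The coefficient of $x^{n+3}$ in $(1 - 2x)\,y^m$.\<close>
  let ?D = "\<lambda>m. quad_coeff m (n + 3) - 2 * quad_coeff m (n + 2)"
  have N: "n + 3 \<le> int N" "n + 2 \<le> int N" "n + 1 \<le> int N" "n \<le> int N" by (auto simp: N_def)
  have op: "op_321 i (int k + 1) = (\<Sum>m\<le>N. ?q m i * ?a m)" "op_321 i (int k) = (\<Sum>m\<le>N. ?q m i * ?b m)"
    if "i \<le> int N" for i
    using op_321_eq_sum[OF that, of "Suc k"] op_321_eq_sum[OF that, of k] by (simp_all add: add.commute)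
  have top: "?q (Suc N) (n + 3) = 0" "?q (Suc N) (n + 2) = 0"
    by (rule quad_coeff_eq_0; simp add: N_def)+
  have e: "n + 3 - 1 = n + 2" "n + 2 - 1 = n + 1" "n + 1 - 1 = n"
    "n + 3 - 2 = n + 1" "n + 2 - 2 = n" by auto
  have lhs: "(n + 4) * (?q m (n + 3) - ?q m (n + 2)) = int (m + 1) * ?D m" for m
    using quad_coeff_derivative[of "n + 3" m] by (simp add: algebra_simps e)
  have rhs: "(4 * n + 10) * ?q m (n + 2) - (8 * n + 14) * ?q m (n + 1) + (4 * n + 4) * ?q m n
      = int (4 * m + 2) * ?D (Suc m)" for m
    using quad_coeff_derivative[of "n + 2" m] quad_coeff_derivative[of "n + 1" m]
    by (simp add: algebra_simps e)
  have "(\<Sum>m\<le>N. (n + 4) * (?q m (n + 3) - ?q m (n + 2)) * ?a m) =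
      (\<Sum>m\<le>N. ?D m * (int (m + 1) * ?a m))"
    by (simp only: lhs mult_ac)
  also have "\<dots> = (\<Sum>m\<le>Suc N. ?D m * (int (m + 1) * ?a m))"
    using top by (simp del: quad_coeff.simps)
  also have "\<dots> = (\<Sum>m\<le>N. ?D (Suc m) * (int (m + 2) * op_coeff (Suc m) (Suc k)))"
    by (subst sum.atMost_Suc_shift) (simp del: quad_coeff.simps op_coeff_simps(4) add: mult_ac)
  also have "\<dots> = (\<Sum>m\<le>N. int (4 * m + 2) * ?D (Suc m) * (?a m + ?b m))"
    using op_coeff_Suc_left[of _ k] by (simp only: mult.assoc mult.left_commute[of "int _"])
  also have "\<dots> = (\<Sum>m\<le>N. ((4 * n + 10) * ?q m (n + 2) - (8 * n + 14) * ?q m (n + 1) + (4 * n + 4) * ?q m n)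
       * (?a m + ?b m))"
    by (simp only: rhs)
  finally have *: "(\<Sum>m\<le>N. (n + 4) * (?q m (n + 3) - ?q m (n + 2)) * ?a m) =
    (\<Sum>m\<le>N. ((4 * n + 10) * ?q m (n + 2) - (8 * n + 14) * ?q m (n + 1) + (4 * n + 4) * ?q m n)
       * (?a m + ?b m))" .
  have **: "(n + 4) * op_321 (n + 3) (int k + 1) - (n + 4) * op_321 (n + 2) (int k + 1) =
     (4 * n + 10) * (op_321 (n + 2) (int k + 1) + op_321 (n + 2) (int k))
     - (8 * n + 14) * (op_321 (n + 1) (int k + 1) + op_321 (n + 1) (int k))
     + (4 * n + 4) * (op_321 n (int k + 1) + op_321 n (int k))"
    using * unfolding op[OF N(1)] op[OF N(2)] op[OF N(3)] op[OF N(4)]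
    by (simp add: algebra_simps sum.distrib sum_subtractf sum_distrib_left)
  then show ?thesis by (simp add: algebra_simps)
qed

text \<open>The variable $x$ enters this relation only through $y = x - x^2$: the differences of consecutive
values in $n$ are multiplications by $y$. It therefore holds separately for each power of $y$, where
it is \<open>op_coeff_Suc_right\<close>.\<close>

lemma op_321_rec_k:
  "(int k + 1) * op_321 (n + 2) (int k + 2) =
     (4 * int k + 4) * (op_321 (n + 1) (int k + 2) - op_321 n (int k + 2))
     - (int k + 2) * op_321 (n + 2) (int k + 1)
     + (8 * int k + 6) * (op_321 (n + 1) (int k + 1) - op_321 n (int k + 1))
     + (4 * int k + 2) * (op_321 (n + 1) (int k) - op_321 n (int k))"
proof -
  define N where "N = nat (n + 2)"
  have N: "n + 2 \<le> int N" "n + 1 \<le> int N" "n \<le> int N" by (auto simp: N_def)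
  let ?q = "\<lambda>m. quad_coeff m"
  let ?d = "\<lambda>m. ?q m (n + 1) - ?q m n"
  let ?A = "\<lambda>m. int (k + 1) * op_coeff m (k + 2) + int (k + 2) * op_coeff m (k + 1)"
  have op: "op_321 i (int k + 2) = (\<Sum>m\<le>N. ?q m i * op_coeff m (k + 2))"
      "op_321 i (int k + 1) = (\<Sum>m\<le>N. ?q m i * op_coeff m (k + 1))"
      "op_321 i (int k) = (\<Sum>m\<le>N. ?q m i * op_coeff m k)"
    if "i \<le> int N" for i
    using op_321_eq_sum[OF that, of "k + 2"] op_321_eq_sum[OF that, of "k + 1"]
      op_321_eq_sum[OF that, of k] by (simp_all add: add.commute)
  have step: "?q (Suc m) (n + 2) = ?d m" for m by (simp add: algebra_simps)
  have top: "?q (Suc N) (n + 2) = 0" by (rule quad_coeff_eq_0) (simp add: N_def)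
  have "(\<Sum>m\<le>N. ?q m (n + 2) * ?A m) = (\<Sum>m\<le>Suc N. ?q m (n + 2) * ?A m)"
    using top by (simp del: quad_coeff.simps)
  also have "\<dots> = (\<Sum>m\<le>N. ?q (Suc m) (n + 2) * ?A (Suc m))"
    by (subst sum.atMost_Suc_shift) (simp del: quad_coeff.simps(2))
  also have "\<dots> = (\<Sum>m\<le>N. ?d m * (int (4 * k + 4) * op_coeff m (k + 2) +
      int (8 * k + 6) * op_coeff m (k + 1) + int (4 * k + 2) * op_coeff m k))"
    by (simp only: step op_coeff_Suc_right)
  finally have *: "(\<Sum>m\<le>N. ?q m (n + 2) * ?A m) =
     (\<Sum>m\<le>N. ?d m * (int (4 * k + 4) * op_coeff m (k + 2) +
      int (8 * k + 6) * op_coeff m (k + 1) + int (4 * k + 2) * op_coeff m k))" .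
  show ?thesis
    using * unfolding op[OF N(1)] op[OF N(2)] op[OF N(3)]
    by (simp add: algebra_simps sum.distrib sum_subtractf sum_distrib_left)
qed

theorem corollary3p8:
  fixes n k :: int
  assumes "k \<ge> 0"
  shows "(n + 4) * op_321 (n + 3) (k + 1) =
           (5 * n + 14) * op_321 (n + 2) (k + 1) + (4 * n + 10) * op_321 (n + 2) k
           - (8 * n + 14) * (op_321 (n + 1) (k + 1) + op_321 (n + 1) k)
           + (4 * n + 4) * (op_321 n (k + 1) + op_321 n k)
       \<and> (k + 1) * op_321 (n + 2) (k + 2) =
           (4 * k + 4) * (op_321 (n + 1) (k + 2) - op_321 n (k + 2))
           - (k + 2) * op_321 (n + 2) (k + 1)
           + (8 * k + 6) * (op_321 (n + 1) (k + 1) - op_321 n (k + 1))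
           + (4 * k + 2) * (op_321 (n + 1) k - op_321 n k)"
  using op_321_rec_n[of n "nat k"] op_321_rec_k[of "nat k" n] assms by simp

end
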